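(* Let $k$ be a positive integer and let $n\ge 6\cdot 2^k+k+4$. Then the hypercube $Q_n$ contains $2^k$ pairwise completely independent spanning trees, each of diameter at most $2(n+9k+11)$.
   Context: The hypercube $Q_n$ has vertex set $\{0,1\}^n$, two vertices being adjacent if they differ in exactly one coordinate. Two spanning trees of a graph $G$ are completely independent if they have no edge in common and, for every pair of vertices $u,v$ of $G$, the $u$–$v$ paths in the two trees have no vertex in common other than $u$ and $v$. The diameter of a tree is the maximum distance within the tree between two of its vertices. *)

theory Defs
  imports "Graph_Theory.Graph_Theory"
begin

text \<open>
  As in the Graph_Theory library, an undirected simple graph is a finite loop-free symmetric
  digraph (locale \<open>pair_graph\<close>): an edge between \<open>u\<close> and \<open>v\<close> is the pair of arcs \<open>(u, v)\<close>, \<open>(v, u)\<close>.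
\<close>

definition hypercube :: "nat \<Rightarrow> bool list pair_pre_digraph" where
  "hypercube n = \<lparr> pverts = {u. length u = n},
     parcs = {(u, v). length u = n \<and> length v = n \<and> (\<exists>!i. i < n \<and> u ! i \<noteq> v ! i)} \<rparr>"

text \<open>
  The library's \<open>forest\<close>, \<open>tree\<close> and \<open>spanning_tree\<close> exclude every directed cycle, hence also the
  closed walk \<open>u, v, u\<close> along any edge of a symmetric digraph. Since \<open>pair_graph\<close> has
  no loops and no parallel arcs, the cycles of the undirected graph are exactly the library's
  cycles with at least three arcs. \<open>Digraph_Component.connected\<close> includes nonemptiness.
\<close>

definition undirected_tree :: "'a pair_pre_digraph \<Rightarrow> bool" where
  "undirected_tree T \<longleftrightarrow> pair_graph T \<and> Digraph_Component.connected (with_proj T) \<and>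
     (\<nexists>c. pre_digraph.cycle (with_proj T) c \<and> 3 \<le> length c)"

definition undirected_spanning_tree :: "'a pair_pre_digraph \<Rightarrow> 'a pair_pre_digraph \<Rightarrow> bool" where
  "undirected_spanning_tree T G \<longleftrightarrow> undirected_tree T \<and> spanning (with_proj T) (with_proj G)"

text \<open>
  Intended for spanning trees \<open>S\<close>, \<open>T\<close> of \<open>G\<close>; both arc sets are then symmetric, so having no
  common arc is the same as having no common edge.
\<close>

definition completely_independent ::
    "'a pair_pre_digraph \<Rightarrow> 'a pair_pre_digraph \<Rightarrow> 'a pair_pre_digraph \<Rightarrow> bool" where
  "completely_independent G S T \<longleftrightarrow> parcs S \<inter> parcs T = {} \<and>
     (\<forall>u\<in>pverts G. \<forall>v\<in>pverts G. \<forall>p q.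
        pre_digraph.apath (with_proj S) u p v \<longrightarrow> pre_digraph.apath (with_proj T) u q v \<longrightarrow>
        set (pre_digraph.awalk_verts (with_proj S) u p) \<inter>
        set (pre_digraph.awalk_verts (with_proj T) u q) \<subseteq> {u, v})"

definition graph_dist :: "'a pair_pre_digraph \<Rightarrow> 'a \<Rightarrow> 'a \<Rightarrow> ereal" where
  "graph_dist G u v = wf_digraph.\<mu> (with_proj G) (\<lambda>_. 1) u v"

definition graph_diameter :: "'a pair_pre_digraph \<Rightarrow> ereal" where
  "graph_diameter G = (SUP u\<in>pverts G. SUP v\<in>pverts G. graph_dist G u v)"

end

theory Submission
  imports Defs
begin

text \<open>
  Colour the vertices of the hypercube with \<open>2 ^ k\<close> colours so that each colour class is connected
  with small radius and every vertex \<open>u\<close> can be given, for each other colour, an edge to a vertex of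
  that colour, without any edge being chosen from both ends. The \<open>i\<close>-th tree is a breadth-first tree
  of colour class \<open>i\<close>, with all other vertices attached as leaves by their chosen edges; inner
  vertices of different trees then have different colours. The colour is the XOR of the labels of
  the coordinates set in one of two blocks, as in a Hamming code, which provides the chosen edges;
  a further coordinate selects the block, so that the coordinates of the unselected block can be
  flipped freely, which makes the colour classes connected.
\<close>

section \<open>Trees given by parent functions\<close>

definition parent_graph :: "'a set \<Rightarrow> 'a \<Rightarrow> ('a \<Rightarrow> 'a) \<Rightarrow> 'a pair_pre_digraph" where
  "parent_graph V r p = \<lparr> pverts = V,
     parcs = {(u, v). u \<in> V \<and> v \<in> V \<and> (u \<noteq> r \<and> v = p u \<or> v \<noteq> r \<and> u = p v)} \<rparr>"

lemma length_pawalk_verts [simp]: "length (pawalk_verts u c) = Suc (length c)"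
  by (induction c arbitrary: u) auto

lemma pawalk_verts_0: "pcas u c v \<Longrightarrow> pawalk_verts u c ! 0 = u"
  by (cases c) auto

lemma pawalk_verts_last: "pcas u c v \<Longrightarrow> pawalk_verts u c ! length c = v"
  by (induction c arbitrary: u) auto

lemma pawalk_verts_nth_arc:
  "pcas u c v \<Longrightarrow> j < length c \<Longrightarrow> (pawalk_verts u c ! j, pawalk_verts u c ! Suc j) = c ! j"
proof (induction c arbitrary: u j)
  case (Cons e es)
  then show ?case
    by (cases j) (auto simp: pawalk_verts_0)
qed simp

text \<open>The depth \<open>d\<close> falls by one along every parent edge. This one certificate
  yields reachability of the root, absence of cycles and a bound on the diameter.\<close>

locale parent_tree =
  fixes V :: "'a set" and r :: 'a and p :: "'a \<Rightarrow> 'a" and d :: "'a \<Rightarrow> nat"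
  assumes finite_V: "finite V" and root: "r \<in> V"
    and parent_in: "v \<in> V \<Longrightarrow> v \<noteq> r \<Longrightarrow> p v \<in> V"
    and parent_depth: "v \<in> V \<Longrightarrow> v \<noteq> r \<Longrightarrow> d v = Suc (d (p v))"
begin

abbreviation T :: "'a pair_pre_digraph" where "T \<equiv> parent_graph V r p"

lemma pverts_T [simp]: "pverts T = V"
  by (simp add: parent_graph_def)

lemma arc_iff:
  "(u, v) \<in> parcs T \<longleftrightarrow> u \<in> V \<and> v \<in> V \<and> (u \<noteq> r \<and> v = p u \<or> v \<noteq> r \<and> u = p v)"
  by (simp add: parent_graph_def)

lemma arc_sym: "(u, v) \<in> parcs T \<Longrightarrow> (v, u) \<in> parcs T"
  by (auto simp: arc_iff)

sublocale pair_graph T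
proof (unfold_locales)
  show "finite (parcs T)"
    by (rule finite_subset[of _ "V \<times> V"]) (auto simp: arc_iff finite_V)
  show "symmetric (with_proj T)"
    by (auto simp: symmetric_def sym_def arc_sym)
  show "fst e \<noteq> snd e" if "e \<in> parcs T" for e
    using that parent_depth by (cases e) (metis arc_iff fst_conv n_not_Suc_n snd_conv)
qed (auto simp: arc_iff finite_V)

text \<open>Depths of adjacent vertices differ by exactly one and the deeper vertex is the child, so
  an arc that does not lead deeper leads to the parent.\<close>

lemma arc_up: "(u, v) \<in> parcs T \<Longrightarrow> d v \<le> d u \<Longrightarrow> v = p u"
  by (auto simp: arc_iff dest: parent_depth)

lemma walk_to_root: "v \<in> V \<Longrightarrow> \<exists>c. awalk v c r \<and> length c \<le> d v"
proof (induction "d v" arbitrary: v rule: less_induct)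
  case less
  show ?case
  proof (cases "v = r")
    case True
    with less.prems show ?thesis by (intro exI[of _ "[]"]) (auto simp: awalk_Nil_iff)
  next
    case False
    with less obtain c where "awalk (p v) c r" "length c \<le> d (p v)"
      by (metis parent_in parent_depth lessI)
    with False less.prems parent_in parent_depth show ?thesis
      by (intro exI[of _ "(v, p v) # c"]) (auto simp: awalk_Cons_iff arc_iff)
  qed
qed

lemma walk_from_root: "v \<in> V \<Longrightarrow> \<exists>c. awalk r c v \<and> length c \<le> d v"
proof (induction "d v" arbitrary: v rule: less_induct)
  case less
  show ?case
  proof (cases "v = r")
    case True
    with less.prems show ?thesis by (intro exI[of _ "[]"]) (auto simp: awalk_Nil_iff)
  next
    case False
    with less obtain c where "awalk r c (p v)" "length c \<le> d (p v)"
      by (metis parent_in parent_depth lessI)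
    moreover have "awalk (p v) [(p v, v)] v"
      using False less.prems parent_in by (auto simp: awalk_simps arc_iff)
    ultimately show ?thesis
      using False less.prems parent_depth by (intro exI[of _ "c @ [(p v, v)]"]) (auto intro: awalk_appendI)
  qed
qed

lemma walk_bound:
  assumes "u \<in> V" "v \<in> V"
  obtains c where "awalk u c v" "length c \<le> d u + d v"
  using walk_to_root[OF assms(1)] walk_from_root[OF assms(2)]
  by (metis add_mono awalk_appendI length_append)

text \<open>Any two vertices are joined by a walk through the root, and its length is at most the
  sum of their depths.\<close>

lemma graph_diameter_le:
  assumes "\<And>v. v \<in> V \<Longrightarrow> d v \<le> R"
  shows "graph_diameter T \<le> ereal (real (2 * R))"
proof -
  have "graph_dist T u v \<le> ereal (real (2 * R))" if uv: "u \<in> V" "v \<in> V" for u v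
  proof -
    obtain c where c: "awalk u c v" "length c \<le> d u + d v"
      using walk_bound[OF uv] .
    have "graph_dist T u v \<le> ereal (awalk_cost (\<lambda>_. 1) c)"
      unfolding graph_dist_def by (rule min_cost_le_walk_cost[OF c(1)])
    also have "awalk_cost (\<lambda>_. 1) c = real (length c)"
      by (simp add: awalk_cost_def sum_list_triv)
    also have "length c \<le> 2 * R"
      using c(2) assms[OF uv(1)] assms[OF uv(2)] by linarith
    finally show ?thesis by simp
  qed
  then show ?thesis
    unfolding graph_diameter_def by (auto intro!: SUP_least)
qed

lemma connected_T: "Digraph_Component.connected (with_proj T)"
proof -
  \<comment> \<open>The arcs are symmetric already, so the symmetric closure inside
    \<open>connected\<close> changes nothing.\<close>
  have "mk_symmetric (with_proj T) = T"
    by (auto simp: mk_symmetric_def parent_graph_def)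
  moreover have "strongly_connected (with_proj T)"
    unfolding strongly_connected_def using root
    by (auto simp: reachable_awalk elim: walk_bound)
  ultimately show ?thesis
    by (simp add: connected_def)
qed

text \<open>At a deepest vertex of the cycle neither neighbour is deeper, so both are its parent;
  with at least three arcs the two neighbours are distinct.\<close>

lemma no_long_cycle:
  assumes "cycle c" "3 \<le> length c"
  shows False
proof -
  define L where "L = length c"
  obtain u where u: "pcas u c u" "set c \<subseteq> parcs T" "distinct (tl (pawalk_verts u c))"
    using assms(1) by (auto simp: cycle_def awalk_def)
  \<comment> \<open>\<open>x\<close> runs round the cycle periodically. The \<open>Suc\<close> skips
    the first entry of the vertex list, which recurs as the last one, so that distinctness of the
    tail applies.\<close>
  define x where "x j = pawalk_verts u c ! Suc (j mod L)" for j
  have L: "L \<ge> 3" using assms(2) by (simp add: L_def)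
  then have mod_L: "j mod L < L" for j by simp
  have arc: "(x j, x (Suc j)) \<in> parcs T" for j
  proof -
    have "x j = pawalk_verts u c ! (Suc j mod L)"
      using L pawalk_verts_0[OF u(1)] pawalk_verts_last[OF u(1)]
      by (auto simp: x_def mod_Suc L_def)
    then show ?thesis
      using pawalk_verts_nth_arc[OF u(1), of "Suc j mod L"] mod_L u(2)
      by (metis L_def nth_mem subsetD x_def)
  qed
  have inj: "i mod L = j mod L" if "x i = x j" for i j
    using nth_eq_iff_index_eq[OF u(3), of "i mod L" "j mod L"] that mod_L[of i] mod_L[of j]
    by (simp add: x_def nth_tl L_def)
  obtain m where m: "m < L" "\<And>j. j < L \<Longrightarrow> d (x j) \<le> d (x m)"
  proof -
    have "Max ((\<lambda>j. d (x j)) ` {..<L}) \<in> (\<lambda>j. d (x j)) ` {..<L}"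
      using L by (intro Max_in) (auto simp: lessThan_empty_iff)
    then obtain m where "m < L" "Max ((\<lambda>j. d (x j)) ` {..<L}) = d (x m)"
      by auto
    then show thesis
      using that Max_ge[of "(\<lambda>j. d (x j)) ` {..<L}"] by (metis finite_imageI finite_lessThan image_eqI lessThan_iff)
  qed
  have max: "d (x j) \<le> d (x m)" for j
    using m(2)[of "j mod L"] L by (simp add: x_def)
  \<comment> \<open>The index \<open>m + L - 1\<close> is the predecessor of \<open>m\<close> on the
    cycle, free of truncated subtraction at \<open>m = 0\<close>.\<close>
  have "x (m + L) = x m" by (simp add: x_def)
  moreover have "Suc (m + L - 1) = m + L" using L by simp
  ultimately have "x (m + L - 1) = p (x m)" "x (Suc m) = p (x m)"
    using arc_up[OF arc_sym[OF arc, of "m + L - 1"]] arc_up[OF arc, of m] max by simp_all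
  then have "(m + L - 1) mod L = Suc m mod L"
    by (intro inj) simp
  \<comment> \<open>Predecessor and successor have congruent indices only if \<open>L\<close>
    divides 2.\<close>
  then show False
    using L m(1) by (cases m) (auto simp: mod_Suc split: if_splits)
qed

lemma undirected_tree_T: "undirected_tree T"
  unfolding undirected_tree_def using pair_graph_axioms connected_T no_long_cycle by blast

text \<open>An interior vertex has two distinct neighbours on the path; without a child, both would
  be its parent. This will force the colour of interior vertices.\<close>

lemma inner_vertex_has_child:
  assumes "apath u c v" "w \<in> set (awalk_verts u c)" "w \<noteq> u" "w \<noteq> v"
  shows "\<exists>x\<in>V. x \<noteq> r \<and> p x = w"
proof (rule ccontr)
  assume no_child: "\<not> ?thesis"
  define xs where "xs = pawalk_verts u c"
  have c: "pcas u c v" "set c \<subseteq> parcs T" "distinct xs"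
    using assms(1) by (auto simp: apath_def awalk_def xs_def)
  obtain j where j: "j < Suc (length c)" "xs ! j = w"
    using assms(2) by (auto simp: in_set_conv_nth xs_def)
  with assms(3,4) c(1) have "j \<noteq> 0" "j \<noteq> length c"
    using pawalk_verts_0[OF c(1)] pawalk_verts_last[OF c(1)] by (metis xs_def)+
  then obtain i where i: "j = Suc i" "Suc i < length c"
    using j(1) by (cases j) auto
  have "(xs ! i, w) \<in> parcs T" "(w, xs ! Suc (Suc i)) \<in> parcs T"
    using pawalk_verts_nth_arc[OF c(1), of i] pawalk_verts_nth_arc[OF c(1), of "Suc i"] i j(2) c(2)
    by (metis Suc_lessD nth_mem subsetD xs_def)+
  with no_child have "xs ! i = p w" "xs ! Suc (Suc i) = p w"
    by (auto simp: arc_iff)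
  then show False
    using nth_eq_iff_index_eq[OF c(3), of i "Suc (Suc i)"] i by (simp add: xs_def)
qed

end

section \<open>Parent functions from shortest walks\<close>

text \<open>Take as depth the length of a shortest \<open>E\<close>-walk to \<open>r\<close>; its
  first step leads exactly one level closer. \<open>E\<close> may be asymmetric: it will relate
  vertices to their admissible parents.\<close>

lemma bfs_parents:
  assumes "\<And>v. v \<in> V \<Longrightarrow> \<exists>m\<le>R. (v, r) \<in> E ^^ m" "E \<subseteq> V \<times> V"
  obtains p and d :: "'a \<Rightarrow> nat" where
    "\<And>v. v \<in> V \<Longrightarrow> d v \<le> R"
    "\<And>v. v \<in> V \<Longrightarrow> v \<noteq> r \<Longrightarrow> (v, p v) \<in> E \<and> d v = Suc (d (p v))"
proof -
  define d where "d v = (LEAST m. (v, r) \<in> E ^^ m)" for v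
  have le: "d v \<le> m" if "(v, r) \<in> E ^^ m" for v m
    using that unfolding d_def by (rule Least_le)
  have mem: "(v, r) \<in> E ^^ d v" if "v \<in> V" for v
    unfolding d_def by (rule LeastI_ex) (use assms(1)[OF that] in blast)
  have "\<exists>w. (v, w) \<in> E \<and> d v = Suc (d w)" if v: "v \<in> V" "v \<noteq> r" for v
  proof -
    obtain m where m: "d v = Suc m"
      using mem[OF v(1)] v(2) by (cases "d v") auto
    then obtain w where w: "(v, w) \<in> E" "(w, r) \<in> E ^^ m"
      using mem[OF v(1)] by (metis relpow_Suc_E2)
    have "(v, r) \<in> E ^^ Suc (d w)"
      using w assms(2) mem[of w] by (blast intro: relpow_Suc_I2)
    then show ?thesis
      using le[OF w(2)] le m w(1) by (metis Suc_le_mono le_antisym)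
  qed
  then obtain p where "\<And>v. v \<in> V \<Longrightarrow> v \<noteq> r \<Longrightarrow> (v, p v) \<in> E \<and> d v = Suc (d (p v))"
    by metis
  moreover have "d v \<le> R" if "v \<in> V" for v
    using assms(1)[OF that] le order_trans by blast
  ultimately show thesis using that by blast
qed

section \<open>A colouring of the hypercube\<close>

abbreviation flip :: "nat \<Rightarrow> bool list \<Rightarrow> bool list" where
  "flip i u \<equiv> u[i := \<not> u ! i]"

lemma differ_once_imp_flip:
  assumes "length u = n" "length v = n" and ex1: "\<exists>!i. i < n \<and> u ! i \<noteq> v ! i"
  shows "\<exists>i<n. v = flip i u"
proof -
  define i where "i = (THE i. i < n \<and> u ! i \<noteq> v ! i)"
  have i: "i < n" "u ! i \<noteq> v ! i"
    using theI'[OF ex1] unfolding i_def by (rule conjunct1, rule conjunct2)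
  have uniq: "u ! j = v ! j" if "j < n" "j \<noteq> i" for j
    using the1_equality[OF ex1, of j] that by (auto simp only: i_def)
  have "v = flip i u"
  proof (rule nth_equalityI)
    fix j assume "j < length v"
    then show "v ! j = flip i u ! j"
      using assms(1,2) i uniq[of j] by (cases "j = i") simp_all
  qed (use assms(1,2) in simp)
  with i(1) show ?thesis by (intro exI conjI)
qed

lemma flip_differs_once:
  assumes "length u = n" "i < n"
  shows "\<exists>!j. j < n \<and> u ! j \<noteq> flip i u ! j"
proof (intro ex1I[of _ i])
  show "j = i" if "j < n \<and> u ! j \<noteq> flip i u ! j" for j
    using that assms by (metis nth_list_update_neq)
qed (use assms in simp)

lemma arcs_hypercube:
  "(u, v) \<in> parcs (hypercube n) \<longleftrightarrow>
     length u = n \<and> length v = n \<and> (\<exists>!i. i < n \<and> u ! i \<noteq> v ! i)"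
  unfolding hypercube_def by (simp only: pair_pre_digraph.select_convs mem_Collect_eq case_prod_conv)

lemma hypercube_arc_iff:
  "(u, v) \<in> parcs (hypercube n) \<longleftrightarrow> length u = n \<and> (\<exists>i<n. v = flip i u)" (is "?L = ?R")
proof
  assume ?L
  then show ?R
    unfolding arcs_hypercube by (intro conjI differ_once_imp_flip[of u n v]) (elim conjE, assumption)+
next
  assume ?R
  then obtain i where i: "i < n" "v = flip i u" "length u = n"
    by blast
  show ?L
    unfolding arcs_hypercube i(2) using i(3) flip_differs_once[OF i(3,1)] by (intro conjI) simp_all
qed

lemma hypercube_arc_sym:
  assumes "(u, v) \<in> parcs (hypercube n)"
  shows "(v, u) \<in> parcs (hypercube n)"
proof -
  obtain i where i: "length u = n" "i < n" "v = flip i u"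
    using assms unfolding hypercube_arc_iff by (elim conjE exE)
  have "u = flip i v"
    unfolding i(3) using i(1,2) by simp
  moreover have "length v = n" using i by simp
  ultimately show ?thesis
    using i(2) unfolding hypercube_arc_iff by (intro conjI exI[of _ i])
qed

section \<open>XOR sums of coordinate labels\<close>

primrec label_sum :: "nat \<Rightarrow> nat \<Rightarrow> bool list \<Rightarrow> nat" where
  "label_sum b 0 u = 0"
| "label_sum b (Suc m) u = xor (label_sum b m u) (if u ! (b + m) then m else 0)"

lemma label_sum_cong:
  "(\<And>j. b \<le> j \<Longrightarrow> j < b + m \<Longrightarrow> u ! j = v ! j) \<Longrightarrow> label_sum b m u = label_sum b m v"
  by (induction m) auto

text \<open>XOR with \<open>g\<close> inserts an absent summand \<open>g\<close> and cancels a
  present one, so one formula serves both values of the flipped bit.\<close>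

lemma label_sum_flip:
  assumes "g < m" "b + g < length u"
  shows "label_sum b m (flip (b + g) u) = xor (label_sum b m u) g"
  using assms
proof (induction m)
  case (Suc m)
  show ?case
  proof (cases "g = m")
    case True
    have "label_sum b m (flip (b + g) u) = label_sum b m u"
      by (rule label_sum_cong) (use True in auto)
    with True Suc.prems show ?thesis by (auto simp: xor.assoc)
  next
    case False
    with Suc show ?thesis by (auto simp: ac_simps)
  qed
qed simp

text \<open>The numbers below \<open>2 ^ k\<close> are those fixed by \<open>take_bit k\<close>,
  which distributes over XOR.\<close>

lemma label_sum_less: "m \<le> 2 ^ k \<Longrightarrow> label_sum b m u < 2 ^ k"
proof (induction m)
  case (Suc m)
  then have "take_bit k (label_sum b (Suc m) u) = label_sum b (Suc m) u"
    by (auto simp: take_bit_nat_eq_self)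
  then show ?case by (simp only: take_bit_nat_eq_self_iff)
qed simp

lemma label_sum_indicator:
  assumes "\<And>j. j < m \<Longrightarrow> u ! (b + j) \<longleftrightarrow> j = c"
  shows "label_sum b m u = (if c < m then c else 0)"
  using assms by (induction m) auto

lemma xor_less_power2: "(a::nat) < 2 ^ k \<Longrightarrow> b < 2 ^ k \<Longrightarrow> xor a b < 2 ^ k"
  by (metis take_bit_nat_eq_self_iff take_bit_xor)

text \<open>
  Coordinate \<open>4 * 2 ^ k\<close> selects which of the two blocks of \<open>2 * 2 ^ k\<close> coordinates determines the
  colour; in each block, every label \<open>g < 2 ^ k\<close> is carried by two coordinates.
\<close>

locale coloured_hypercube =
  fixes k n q :: nat
  assumes q: "q = 2 ^ k" and n: "4 * q < n"
begin

definition block :: "bool \<Rightarrow> nat" where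
  "block z = (if z then 2 * q else 0)"

definition block_colour :: "bool \<Rightarrow> bool list \<Rightarrow> nat" where
  "block_colour z u = xor (label_sum (block z) q u) (label_sum (block z + q) q u)"

definition colour :: "bool list \<Rightarrow> nat" where
  "colour u = block_colour (u ! (4 * q)) u"

text \<open>
  Flipping either of the two active coordinates with the right label changes the colour of \<open>u\<close>
  to \<open>i\<close>. Choosing between them as below traverses each of the resulting 4-cycles cyclically, so
  no edge is chosen from both of its ends.
\<close>

definition exit_coord :: "nat \<Rightarrow> bool list \<Rightarrow> nat" where
  "exit_coord i u = (let a = block (u ! (4 * q)) + xor (colour u) i
     in if u ! a = u ! (a + q) then a else a + q)"

definition exit_to :: "nat \<Rightarrow> bool list \<Rightarrow> bool list" where
  "exit_to i u = flip (exit_coord i u) u"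

text \<open>Oriented from a vertex to its admissible parents in the \<open>i\<close>-th tree: inside
  the colour class every edge is allowed, from outside only the chosen exit edge. Parents always
  have colour \<open>i\<close>.\<close>

definition step :: "nat \<Rightarrow> (bool list \<times> bool list) set" where
  "step i = {(u, v). length u = n \<and> colour v = i \<and>
     (if colour u = i then \<exists>j<n. v = flip j u else v = exit_to i u)}"

text \<open>For \<open>i < q\<close>, each block has a single set bit, of label \<open>i\<close>, so
  both block colours are \<open>i\<close> and the selector can be flipped without changing the
  colour.\<close>

definition root :: "nat \<Rightarrow> bool list" where
  "root i = map (\<lambda>j. j = i \<or> j = 2 * q + i \<or> j = 4 * q) [0..<n]"

lemma length_root [simp]: "length (root i) = n"
  by (simp add: root_def)

section \<open>Colours and exit edges\<close>

lemma block_colour_cong: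
  assumes "\<And>j. block z \<le> j \<Longrightarrow> j < block z + 2 * q \<Longrightarrow> u ! j = v ! j"
  shows "block_colour z u = block_colour z v"
  unfolding block_colour_def by (intro arg_cong2[of _ _ _ _ xor] label_sum_cong assms) auto

lemma xor_less: "a < q \<Longrightarrow> b < q \<Longrightarrow> xor a b < q"
  unfolding q by (rule xor_less_power2)

lemma colour_less: "colour u < q"
  unfolding colour_def block_colour_def
  by (intro xor_less) (auto simp: q intro: label_sum_less)

lemma block_colour_root: "i < q \<Longrightarrow> block_colour z (root i) = i"
  \<comment> \<open>The second instance takes \<open>c = q\<close>, outside the range: the second
    half of each block of the root has no set bit and contributes 0.\<close>
  using n label_sum_indicator[of q "root i" "block z" i] label_sum_indicator[of q "root i" "block z + q" q]
  by (auto simp: block_colour_def block_def root_def)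

lemma exit_coord_less: "i < q \<Longrightarrow> exit_coord i u < 4 * q"
  using xor_less[OF colour_less[of u], of i]
  by (auto simp: exit_coord_def Let_def block_def)

text \<open>With \<open>g\<close> the XOR of the old and the new colour, flipping either coordinate
  of label \<open>g\<close> in the active block turns one into the other; the selector is not
  touched.\<close>

lemma colour_exit_to:
  assumes "length u = n" "i < q"
  shows "colour (exit_to i u) = i"
proof -
  define g where "g = xor (colour u) i"
  define b where "b = block (u ! (4 * q))"
  have g: "g < q"
    using xor_less[OF colour_less assms(2)] by (simp add: g_def)
  have b: "b + 2 * q \<le> 4 * q" by (simp add: b_def block_def)
  have sel: "exit_to i u ! (4 * q) = u ! (4 * q)"
    using exit_coord_less[OF assms(2), of u] by (simp add: exit_to_def)
  have "xor (label_sum b q (exit_to i u)) (label_sum (b + q) q (exit_to i u))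
      = xor (xor (label_sum b q u) (label_sum (b + q) q u)) g"
  proof (cases "u ! (b + g) = u ! (b + g + q)")
    case True
    then have ex: "exit_to i u = flip (b + g) u"
      by (simp add: exit_to_def exit_coord_def b_def g_def Let_def)
    have "label_sum (b + q) q (exit_to i u) = label_sum (b + q) q u"
      unfolding ex by (rule label_sum_cong) (use g in auto)
    moreover have "label_sum b q (exit_to i u) = xor (label_sum b q u) g"
      unfolding ex by (rule label_sum_flip) (use g b n assms(1) in auto)
    ultimately show ?thesis
      by (simp add: ac_simps)
  next
    case False
    then have ex: "exit_to i u = flip (b + q + g) u"
      by (simp add: exit_to_def exit_coord_def b_def g_def Let_def ac_simps)
    have "label_sum b q (exit_to i u) = label_sum b q u"
      unfolding ex by (rule label_sum_cong) (use g in auto)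
    moreover have "label_sum (b + q) q (exit_to i u) = xor (label_sum (b + q) q u) g"
      unfolding ex by (rule label_sum_flip) (use g b n assms(1) in auto)
    ultimately show ?thesis
      by (simp add: ac_simps)
  qed
  then have "colour (exit_to i u) = xor (colour u) g"
    by (simp add: colour_def block_colour_def sel b_def)
  then show ?thesis
    by (simp add: g_def flip: xor.assoc)
qed

text \<open>Both ends use the label \<open>xor i j\<close> and the same block, hence the same
  coordinate pair \<open>a\<close>, \<open>a + q\<close>. The first flip toggles whether these two
  bits agree, so the second vertex picks the other coordinate and does not return.\<close>

lemma exit_to_antisym:
  assumes "length u = n" "i < q" "j < q" "colour u = j" "colour v = i" "v = exit_to i u" "u = exit_to j v"
  shows False
proof -
  define a where "a = block (u ! (4 * q)) + xor i j"
  have a: "a + q < 4 * q" "a + q < n"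
    using xor_less[OF assms(2,3)] n by (auto simp: a_def block_def)
  have sel: "v ! (4 * q) = u ! (4 * q)"
    using exit_coord_less[OF assms(2), of u] assms(6) by (simp add: exit_to_def)
  have u: "exit_coord i u = (if u ! a = u ! (a + q) then a else a + q)"
    by (simp add: exit_coord_def a_def Let_def assms(4) xor.commute)
  have v: "exit_coord j v = (if v ! a = v ! (a + q) then a else a + q)"
    by (simp add: exit_coord_def a_def Let_def assms(5) sel)
  have q0: "q \<noteq> 0" by (simp add: q)
  have "v ! exit_coord i u \<noteq> u ! exit_coord i u"
    using a u assms(1,6) by (auto simp: exit_to_def)
  moreover have "exit_coord j v \<noteq> exit_coord i u"
    using a u v q0 assms(1,6) by (auto simp: exit_to_def nth_list_update split: if_splits)
  ultimately show False
    using assms(7) by (metis exit_to_def nth_list_update_neq)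
qed

text \<open>In equal orientation the target would have two colours. In opposite orientation each end
  has the colour of the other tree, so both steps are exit edges, against
  \<open>exit_to_antisym\<close>.\<close>

lemma step_disjoint:
  assumes "i < q" "j < q" "i \<noteq> j" "(u, v) \<in> step i"
  shows "(u, v) \<notin> step j" "(v, u) \<notin> step j"
proof -
  show "(u, v) \<notin> step j"
    using assms by (simp add: step_def)
  show "(v, u) \<notin> step j"
  proof
    assume "(v, u) \<in> step j"
    with assms(4) have c: "colour u = j" "colour v = i" "length u = n"
      by (simp_all add: step_def)
    from \<open>(v, u) \<in> step j\<close> c assms(3) have "u = exit_to j v"
      by (simp only: step_def mem_Collect_eq case_prod_conv if_False)
    moreover from assms(4) c assms(3) have "v = exit_to i u"
      by (simp only: step_def mem_Collect_eq case_prod_conv if_False not_sym)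
    ultimately show False
      using exit_to_antisym[OF c(3) assms(1,2) c(1,2)] by blast
  qed
qed

lemma step_subset_hypercube: "i < q \<Longrightarrow> step i \<subseteq> parcs (hypercube n)"
proof (rule subrelI)
  fix u v assume "i < q" "(u, v) \<in> step i"
  moreover from this have "exit_coord i u < n"
    using exit_coord_less[of i u] n by linarith
  ultimately show "(u, v) \<in> parcs (hypercube n)"
    unfolding step_def hypercube_arc_iff exit_to_def by (auto simp del: not_ex split: if_splits)
qed

section \<open>Short walks inside a colour class\<close>

text \<open>Adjust the coordinates in \<open>D\<close> one at a time. Every intermediate vertex
  agrees with \<open>v\<close> outside \<open>D\<close>, so the last hypothesis keeps its colour at
  \<open>i\<close>.\<close>

lemma monochromatic_walk:
  assumes "finite D" "length u = n" "length v = n"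
    and "\<And>j. j < n \<Longrightarrow> j \<notin> D \<Longrightarrow> u ! j = v ! j"
    and "\<And>w. length w = n \<Longrightarrow> (\<And>j. j < n \<Longrightarrow> j \<notin> D \<Longrightarrow> w ! j = v ! j) \<Longrightarrow> colour w = i"
  shows "\<exists>m\<le>card D. (u, v) \<in> step i ^^ m"
  using assms
proof (induction D arbitrary: u rule: finite_induct)
  case empty
  then have "u = v" by (intro nth_equalityI) auto
  then show ?case by auto
next
  case (insert x D)
  define u' where "u' = u[x := v ! x]"
  have u': "length u' = n"
    using insert.prems(1) by (simp add: u'_def)
  have u'_nth: "u' ! j = v ! j" if "j < n" "j \<notin> D" for j
    using insert.prems(1) insert.prems(3)[of j] that by (cases "j = x") (simp_all add: u'_def)
  obtain m where m: "m \<le> card D" "(u', v) \<in> step i ^^ m"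
    using insert.IH[OF u' insert.prems(2) u'_nth] insert.prems(4) by blast
  show ?case
  proof (cases "u' = u")
    \<comment> \<open>This covers both a bit that is already right and an index \<open>x\<close>
      beyond the list, where the update does nothing.\<close>
    case True
    with m insert.hyps show ?thesis by (intro exI[of _ m]) auto
  next
    case False
    then have "x < n"
      using insert.prems(1) list_update_beyond[of u x] unfolding u'_def by (metis not_le)
    moreover have "v ! x \<noteq> u ! x"
    proof
      assume "v ! x = u ! x"
      then have "u' = u" unfolding u'_def by (simp only: list_update_id)
      with False show False ..
    qed
    then have "v ! x = (\<not> u ! x)" by blast
    then have "u' = flip x u"
      by (simp add: u'_def)
    moreover have "colour u = i" "colour u' = i"
      using insert.prems u' u'_nth by auto
    ultimately have "(u, u') \<in> step i"
      using insert.prems(1) by (auto simp: step_def)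
    then have "(u, v) \<in> step i ^^ Suc m"
      using m(2) by (rule relpow_Suc_I2)
    with m(1) insert.hyps show ?thesis
      by (intro exI[of _ "Suc m"]) simp
  qed
qed

text \<open>
  While one block is active, the other one can be rewritten freely. So rewrite the inactive block
  to that of the root, switch blocks, rewrite the first block, and adjust the selector.
\<close>

lemma colour_class_walk:
  assumes "i < q" "length u = n" "colour u = i"
  shows "\<exists>m\<le>n + 1. (u, root i) \<in> step i ^^ m"
proof -
  define z where "z = u ! (4 * q)"
  \<comment> \<open>\<open>B\<close> is the active block of \<open>u\<close>; \<open>C\<close> is
    everything else except the selector and thus contains the inactive block.\<close>
  define B where "B = {block z..<block z + 2 * q}"
  define C where "C = {..<n} - insert (4 * q) B"
  define v1 where "v1 = map (\<lambda>j. if j \<in> C then root i ! j else u ! j) [0..<n]"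
  define v2 where "v2 = flip (4 * q) v1"
  define v3 where "v3 = (root i)[4 * q := \<not> z]"
  have B: "B \<subseteq> {..<4 * q}" by (auto simp: B_def block_def)
  have len: "length v1 = n" "length v2 = n" "length v3 = n"
    by (auto simp: v1_def v2_def v3_def)
  have nth: "v1 ! j = (if j \<in> C then root i ! j else u ! j)"
    "v2 ! j = (if j = 4 * q then \<not> z else v1 ! j)"
    "v3 ! j = (if j = 4 * q then \<not> z else root i ! j)" if "j < n" for j
    using that n len by (auto simp: v1_def v2_def v3_def z_def C_def nth_list_update)
  have inactive: "block_colour (\<not> z) w = i"
    if "\<And>j. j \<in> C \<Longrightarrow> w ! j = root i ! j" for w
  proof -
    have "block_colour (\<not> z) w = block_colour (\<not> z) (root i)"
      by (rule block_colour_cong) (rule that, use n in \<open>auto simp: C_def B_def block_def split: if_splits\<close>)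
    then show ?thesis using block_colour_root[OF assms(1)] by simp
  qed
  have active: "block_colour z w = i" if "\<And>j. j \<in> B \<Longrightarrow> w ! j = u ! j" for w
    using block_colour_cong[of z w u] that assms(3) by (auto simp: colour_def B_def z_def)
  \<comment> \<open>\<open>B\<close>, \<open>C\<close> and the selector partition the
    \<open>n\<close> coordinates; at most two selector flips then give the bound
    \<open>n + 1\<close>.\<close>
  have card: "card C + card B = n - 1" "finite C" "finite B"
  proof -
    show "finite C" "finite B" by (auto simp: B_def C_def)
    have "card C = n - card (insert (4 * q) B)"
      unfolding C_def using n by (subst card_Diff_subset) (auto simp: B_def block_def)
    moreover have "card (insert (4 * q) B) = Suc (card B)"
      by (subst card_insert_disjoint) (auto simp: B_def block_def)
    moreover have "card B \<le> 4 * q"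
      using card_mono[OF _ B] by simp
    ultimately show "card C + card B = n - 1" using n by simp
  qed
  obtain m1 where m1: "m1 \<le> card C" "(u, v1) \<in> step i ^^ m1"
  proof -
    have "colour w = i" if w: "length w = n" "\<And>j. j < n \<Longrightarrow> j \<notin> C \<Longrightarrow> w ! j = v1 ! j" for w
    proof -
      have "w ! (4 * q) = z" "\<And>j. j \<in> B \<Longrightarrow> w ! j = u ! j"
        using w nth(1) n B by (force simp: C_def z_def)+
      then show ?thesis using active by (simp add: colour_def)
    qed
    then show thesis
      using monochromatic_walk[of C u v1 i] that card(2) assms(2) len nth(1) by auto
  qed
  obtain m2 where m2: "m2 \<le> 1" "(v1, v2) \<in> step i ^^ m2"
  proof -
    \<comment> \<open>Block \<open>z\<close> still agrees with \<open>u\<close> and the other block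
      already with the root, so both selector values give colour \<open>i\<close>.\<close>
    have "colour w = i" if w: "length w = n" "\<And>j. j < n \<Longrightarrow> j \<notin> {4 * q} \<Longrightarrow> w ! j = v2 ! j" for w
    proof -
      have "block_colour z w = i"
        by (rule active) (use w nth n B in \<open>force simp: C_def\<close>)
      moreover have "block_colour (\<not> z) w = i"
        by (rule inactive) (use w nth n in \<open>force simp: C_def\<close>)
      ultimately show ?thesis by (cases "w ! (4 * q)"; cases z) (auto simp: colour_def)
    qed
    then show thesis
      using monochromatic_walk[of "{4 * q}" v1 v2 i] that len nth(2) by auto
  qed
  obtain m3 where m3: "m3 \<le> card B" "(v2, v3) \<in> step i ^^ m3"
  proof -
    have "colour w = i" if w: "length w = n" "\<And>j. j < n \<Longrightarrow> j \<notin> B \<Longrightarrow> w ! j = v3 ! j" for w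
    proof -
      have "w ! (4 * q) = (\<not> z)"
        using w nth(3) n B by force
      moreover have "block_colour (\<not> z) w = i"
        by (rule inactive) (use w nth n in \<open>force simp: C_def\<close>)
      ultimately show ?thesis by (simp add: colour_def)
    qed
    moreover have "v2 ! j = v3 ! j" if "j < n" "j \<notin> B" for j
      using nth[OF that(1)] that by (simp add: C_def)
    ultimately show thesis
      using that monochromatic_walk[OF card(3) len(2,3)] by blast
  qed
  obtain m4 where m4: "m4 \<le> 1" "(v3, root i) \<in> step i ^^ m4"
  proof -
    \<comment> \<open>Only the selector may still differ from the root, and both block colours of
      the root are \<open>i\<close>.\<close>
    have "colour w = i" if w: "length w = n" "\<And>j. j < n \<Longrightarrow> j \<notin> {4 * q} \<Longrightarrow> w ! j = root i ! j" for w
    proof -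
      have "block_colour (w ! (4 * q)) w = block_colour (w ! (4 * q)) (root i)"
        by (rule block_colour_cong) (use w n in \<open>auto simp: block_def split: if_splits\<close>)
      then show ?thesis using block_colour_root[OF assms(1)] by (simp add: colour_def)
    qed
    then show thesis
      using monochromatic_walk[of "{4 * q}" v3 "root i" i] that len nth(3) by auto
  qed
  have "(u, root i) \<in> step i ^^ (m1 + m2 + m3 + m4)"
    unfolding relpow_add using m1(2) m2(2) m3(2) m4(2) by blast
  moreover have "m1 + m2 + m3 + m4 \<le> n + 1"
    using m1(1) m2(1) m3(1) m4(1) card(1) n by linarith
  ultimately show ?thesis by blast
qed

text \<open>A vertex of another colour first takes its exit edge, which costs one more step.\<close>

lemma walk_to_root:
  assumes "i < q" "length u = n"
  shows "\<exists>m\<le>n + 2. (u, root i) \<in> step i ^^ m"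
proof (cases "colour u = i")
  case True
  then show ?thesis using colour_class_walk[OF assms] by (meson add_le_mono le_refl le_trans one_le_numeral)
next
  case False
  have c: "colour (exit_to i u) = i" by (rule colour_exit_to[OF assms(2,1)])
  then have exit: "(u, exit_to i u) \<in> step i"
    using False assms by (simp add: step_def)
  have "length (exit_to i u) = n"
    using assms(2) by (simp add: exit_to_def)
  from colour_class_walk[OF assms(1) this c]
  obtain m where m: "m \<le> n + 1" "(exit_to i u, root i) \<in> step i ^^ m"
    by blast
  show ?thesis
    using m(1) relpow_Suc_I2[OF exit m(2)] by (intro exI[of _ "Suc m"]) simp
qed

section \<open>Assembling the trees\<close>

lemma spanning_tree_exists:
  assumes "i < q"
  shows "\<exists>p d. parent_tree {u. length u = n} (root i) p d \<and>
    (\<forall>u. length u = n \<longrightarrow> d u \<le> n + 2 \<and> (u \<noteq> root i \<longrightarrow> (u, p u) \<in> step i))"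
proof -
  have sub: "step i \<subseteq> {u. length u = n} \<times> {u. length u = n}"
    using step_subset_hypercube[OF assms] by (auto simp: arcs_hypercube)
  have reach: "\<exists>m\<le>n + 2. (v, root i) \<in> step i ^^ m" if "v \<in> {u. length u = n}" for v
    using walk_to_root[OF assms] that by simp
  obtain p d where pd:
    "\<And>u. u \<in> {u. length u = n} \<Longrightarrow> d u \<le> n + 2"
    "\<And>u. u \<in> {u. length u = n} \<Longrightarrow> u \<noteq> root i \<Longrightarrow> (u, p u) \<in> step i \<and> d u = Suc (d (p u))"
    by (rule bfs_parents[OF reach sub], assumption) (rule that)
  have "parent_tree {u. length u = n} (root i) p d"
  proof
    show "finite {u :: bool list. length u = n}"
      using finite_lists_length_eq[of "UNIV :: bool set" n] by simp
  next
    fix u :: "bool list" assume u: "u \<in> {u. length u = n}" "u \<noteq> root i"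
    show "p u \<in> {u. length u = n}" using pd(2)[OF u] sub by blast
    show "d u = Suc (d (p u))" using pd(2)[OF u] by blast
  qed simp
  moreover have "\<forall>u. length u = n \<longrightarrow> d u \<le> n + 2 \<and> (u \<noteq> root i \<longrightarrow> (u, p u) \<in> step i)"
    using pd by simp
  ultimately show ?thesis by blast
qed

lemma spanning_trees:
  "\<exists>\<T> :: bool list pair_pre_digraph set. card \<T> = q \<and>
     (\<forall>T\<in>\<T>. undirected_spanning_tree T (hypercube n)) \<and>
     pairwise (completely_independent (hypercube n)) \<T> \<and>
     (\<forall>T\<in>\<T>. graph_diameter T \<le> ereal (real (2 * (n + 2))))"
proof -
  define V :: "bool list set" where "V = {u. length u = n}"
  have "\<forall>i\<in>{..<q}. \<exists>p d. parent_tree V (root i) p d \<and>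
      (\<forall>u\<in>V. d u \<le> n + 2 \<and> (u \<noteq> root i \<longrightarrow> (u, p u) \<in> step i))"
    using spanning_tree_exists by (simp add: V_def)
  then obtain p d where pd: "\<And>i. i < q \<Longrightarrow> parent_tree V (root i) (p i) (d i)"
    "\<And>i u. i < q \<Longrightarrow> u \<in> V \<Longrightarrow> d i u \<le> n + 2"
    "\<And>i u. i < q \<Longrightarrow> u \<in> V \<Longrightarrow> u \<noteq> root i \<Longrightarrow> (u, p i u) \<in> step i"
    by (metis lessThan_iff)
  define T where "T i = parent_graph V (root i) (p i)" for i
  have arcs: "(u, v) \<in> step i \<or> (v, u) \<in> step i" if "i < q" "(u, v) \<in> parcs (T i)" for i u v
    using that pd(3)[OF that(1)] by (auto simp: T_def parent_graph_def)
  have disjoint: "parcs (T i) \<inter> parcs (T j) = {}" if "i < q" "j < q" "i \<noteq> j" for i j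
  proof (rule equals0I)
    fix e assume "e \<in> parcs (T i) \<inter> parcs (T j)"
    then obtain u v where "(u, v) \<in> parcs (T i)" "(u, v) \<in> parcs (T j)"
      by (cases e) blast
    with arcs that have "(u, v) \<in> step i \<or> (v, u) \<in> step i" "(u, v) \<in> step j \<or> (v, u) \<in> step j"
      by blast+
    with step_disjoint[OF that] show False by blast
  qed
  \<comment> \<open>An interior vertex \<open>w\<close> has a child, and the step from that child to
    \<open>w\<close> forces the colour of \<open>w\<close>. A common interior vertex of paths in two
    trees would thus have two colours.\<close>
  have inner: "colour w = i"
    if path: "i < q" "pre_digraph.apath (with_proj (T i)) u c v"
      "w \<in> set (pre_digraph.awalk_verts (with_proj (T i)) u c)" "w \<noteq> u" "w \<noteq> v" for i u c v w
  proof -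
    interpret parent_tree V "root i" "p i" "d i" using pd(1)[OF path(1)] .
    obtain x where "x \<in> V" "x \<noteq> root i" "p i x = w"
      using inner_vertex_has_child path(2-5) unfolding T_def awalk_verts_with_proj_eq by blast
    with pd(3)[OF path(1), of x] show ?thesis by (auto simp: step_def)
  qed
  have indep: "completely_independent (hypercube n) (T i) (T j)" if "i < q" "j < q" "i \<noteq> j" for i j
    unfolding completely_independent_def using disjoint[OF that] inner that by blast
  \<comment> \<open>Equal trees would share all arcs, against disjointness;
    \<open>flip 0 (root i)\<close> is a non-root vertex, whose parent edge shows that there is an
    arc.\<close>
  have "inj_on T {..<q}"
  proof (rule inj_onI, rule ccontr)
    fix i j assume ij: "i \<in> {..<q}" "j \<in> {..<q}" "T i = T j" "i \<noteq> j"
    interpret parent_tree V "root i" "p i" "d i" using pd(1) ij(1) by simp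
    have "flip 0 (root i) \<in> V" "flip 0 (root i) \<noteq> root i"
      using n by (auto simp: V_def list_eq_iff_nth_eq intro!: exI[of _ 0])
    then have "(flip 0 (root i), p i (flip 0 (root i))) \<in> parcs (T i)"
      using parent_in by (simp add: T_def arc_iff)
    then show False using disjoint[of i j] ij by auto
  qed
  then have "card (T ` {..<q}) = q" by (simp add: card_image)
  moreover have "undirected_spanning_tree (T i) (hypercube n) \<and>
      graph_diameter (T i) \<le> ereal (real (2 * (n + 2)))" if i: "i < q" for i
  proof -
    interpret parent_tree V "root i" "p i" "d i" using pd(1)[OF i] .
    have "parcs (T i) \<subseteq> parcs (hypercube n)"
      using arcs[OF i] step_subset_hypercube[OF i] hypercube_arc_sym by fast
    moreover have "pverts (T i) = pverts (hypercube n)"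
      unfolding T_def pverts_T by (simp add: V_def hypercube_def)
    moreover have "wf_digraph (with_proj (hypercube n))"
      by (simp add: wf_digraph_def arcs_hypercube) (simp add: hypercube_def)
    moreover have "wf_digraph (with_proj (T i))"
      using wf_digraph_axioms by (simp add: T_def)
    ultimately have "spanning (with_proj (T i)) (with_proj (hypercube n))"
      by (simp add: spanning_def subgraph_def compatible_def)
    then show ?thesis
      using undirected_tree_T graph_diameter_le[of "n + 2"] pd(2)[OF i]
      by (simp add: undirected_spanning_tree_def T_def)
  qed
  moreover have "pairwise (completely_independent (hypercube n)) (T ` {..<q})"
    using indep by (auto simp: pairwise_def)
  ultimately show ?thesis by (intro exI[of _ "T ` {..<q}"]) auto
qed

end

theorem theorem5:
  fixes k n :: nat
  assumes "k \<ge> 1"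
    and "n \<ge> 6 * 2 ^ k + k + 4"
  shows "\<exists>\<T> :: bool list pair_pre_digraph set.
           card \<T> = 2 ^ k \<and>
           (\<forall>T\<in>\<T>. undirected_spanning_tree T (hypercube n)) \<and>
           pairwise (completely_independent (hypercube n)) \<T> \<and>
           (\<forall>T\<in>\<T>. graph_diameter T \<le> ereal (real (2 * (n + 9 * k + 11))))"
proof -
  interpret coloured_hypercube k n "2 ^ k"
    using assms(2) by unfold_locales auto
  \<comment> \<open>Every tree has depth at most \<open>n + 2\<close>, which lies below
    \<open>n + 9 * k + 11\<close>.\<close>
  have le: "ereal (real (2 * (n + 2))) \<le> ereal (real (2 * (n + 9 * k + 11)))"
    by simp
  show ?thesis
    by (rule ex_forward[OF spanning_trees]) (blast intro: order_trans[OF _ le])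
qed

end
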